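(* Let $t\ge 3$, let $j',j'',j$ be positive integers with $j<\min\{j',j''\}$ and $j'+j''-j<t$, and let $\ell^{\triangle},\ell^{\cap},\ell\in\{1,\ldots,t\}$ be odd. Let $\mathcal{F}$ be the family of all ordered pairs $(A,B)$ of subsets of $E_t=\{1,\ldots,t\}$ such that $$|A|=j'<t,\quad |B|=j''<t,\quad 0<|A\cap B|=j,\quad \max\{j',j''\}<|A\cup B|<t,$$ $$\mathfrak{q}(A\triangle B)=\ell^{\triangle},\quad \mathfrak{q}(A\cap B)=\ell^{\cap},\quad \mathfrak{q}(A\cup B)=\ell.$$ Put $n:=t-(j'+j''-j)$ and $N:=j'+j''-2j$. Then: (i) The number of pairs $(A,B)\in\mathcal{F}$ with $\{1,t\}\cap A=\{1,t\}\cap B=\{1\}$ is $$\mathfrak{T}\left(\beta,\theta;\tfrac{\ell+1}{2},\tfrac{\ell^{\triangle}-1}{2},\tfrac{\ell^{\cap}+1}{2}\right)\cdot\mathtt{c}\bigl(\tfrac{\ell+1}{2};n\bigr)\cdot\mathtt{c}\bigl(\tfrac{\ell^{\triangle}-1}{2};N\bigr)\cdot\mathtt{c}\bigl(\tfrac{\ell^{\cap}+1}{2};j\bigr)\cdot\binom{N}{j'-j}.$$ (ii) The number of pairs $(A,B)\in\mathcal{F}$ with $\{1,t\}\cap A=\{1\}$ and $\{1,t\}\cap B=\{1,t\}$ is $$\mathfrak{T}\left(\beta,\alpha;\tfrac{\ell-1}{2},\tfrac{\ell^{\triangle}+1}{2},\tfrac{\ell^{\cap}+1}{2}\right)\cdot\mathtt{c}\bigl(\tfrac{\ell-1}{2};n\bigr)\cdot\mathtt{c}\bigl(\tfrac{\ell^{\triangle}+1}{2};N\bigr)\cdot\mathtt{c}\bigl(\tfrac{\ell^{\cap}+1}{2};j\bigr)\cdot\binom{N-1}{j'-j}.$$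 (iii) The number of pairs $(A,B)\in\mathcal{F}$ with $\{1,t\}\cap A=\{1\}$ and $|\{1,t\}\cap B|=0$ is $$\mathfrak{T}\left(\alpha,\theta;\tfrac{\ell+1}{2},\tfrac{\ell^{\triangle}+1}{2},\tfrac{\ell^{\cap}-1}{2}\right)\cdot\mathtt{c}\bigl(\tfrac{\ell+1}{2};n\bigr)\cdot\mathtt{c}\bigl(\tfrac{\ell^{\triangle}+1}{2};N\bigr)\cdot\mathtt{c}\bigl(\tfrac{\ell^{\cap}-1}{2};j\bigr)\cdot\binom{N-1}{j''-j}.$$ (iv) The number of pairs $(A,B)\in\mathcal{F}$ with $\{1,t\}\cap A=\{1\}$ and $\{1,t\}\cap B=\{t\}$ is $$\mathfrak{T}\left(\alpha,\alpha;\tfrac{\ell-1}{2},\tfrac{\ell^{\triangle}+1}{2},\tfrac{\ell^{\cap}-1}{2}\right)\cdot\mathtt{c}\bigl(\tfrac{\ell-1}{2};n\bigr)\cdot\mathtt{c}\bigl(\tfrac{\ell^{\triangle}+1}{2};N\bigr)\cdot\mathtt{c}\bigl(\tfrac{\ell^{\cap}-1}{2};j\bigr)\cdot\binom{N-2}{j'-j-1}.$$ (v) The number of pairs $(A,B)\in\mathcal{F}$ with $\{1,t\}\cap A=\{1,t\}\cap B=\{1,t\}$ is $$\mathfrak{T}\left(\beta,\beta;\tfrac{\ell-1}{2},\tfrac{\ell^{\triangle}-1}{2},\tfrac{\ell^{\cap}+1}{2}\right)\cdot\mathtt{c}\bigl(\tfrac{\ell-1}{2};n\bigr)\cdot\mathtt{c}\bigl(\tfrac{\ell^{\triangle}-1}{2};N\bigr)\cdot\mathtt{c}\bigl(\tfrac{\ell^{\cap}+1}{2};j\bigr)\cdot\binom{N}{j'-j}.$$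 (vi) The number of pairs $(A,B)\in\mathcal{F}$ with $\{1,t\}\cap A=\{1,t\}$ and $|\{1,t\}\cap B|=0$ is $$\mathfrak{T}\left(\alpha,\alpha;\tfrac{\ell-1}{2},\tfrac{\ell^{\triangle}+1}{2},\tfrac{\ell^{\cap}-1}{2}\right)\cdot\mathtt{c}\bigl(\tfrac{\ell-1}{2};n\bigr)\cdot\mathtt{c}\bigl(\tfrac{\ell^{\triangle}+1}{2};N\bigr)\cdot\mathtt{c}\bigl(\tfrac{\ell^{\cap}-1}{2};j\bigr)\cdot\binom{N-2}{j''-j}.$$ (vii) The number of pairs $(A,B)\in\mathcal{F}$ with $\{1,t\}\cap A=\{1,t\}$ and $\{1,t\}\cap B=\{t\}$ is $$\mathfrak{T}\left(\alpha,\beta;\tfrac{\ell-1}{2},\tfrac{\ell^{\triangle}+1}{2},\tfrac{\ell^{\cap}+1}{2}\right)\cdot\mathtt{c}\bigl(\tfrac{\ell-1}{2};n\bigr)\cdot\mathtt{c}\bigl(\tfrac{\ell^{\triangle}+1}{2};N\bigr)\cdot\mathtt{c}\bigl(\tfrac{\ell^{\cap}+1}{2};j\bigr)\cdot\binom{N-1}{j''-j}.$$ (viii) The number of pairs $(A,B)\in\mathcal{F}$ with $|\{1,t\}\cap A|=|\{1,t\}\cap B|=0$ is $$\mathfrak{T}\left(\theta,\theta;\tfrac{\ell+1}{2},\tfrac{\ell^{\triangle}-1}{2},\tfrac{\ell^{\cap}-1}{2}\right)\cdot\mathtt{c}\bigl(\tfrac{\ell+1}{2};n\bigr)\cdot\mathtt{c}\bigl(\tfrac{\ell^{\triangle}-1}{2};N\bigr)\cdot\mathtt{c}\bigl(\tfrac{\ell^{\cap}-1}{2};j\bigr)\cdot\binom{N}{j'-j}.$$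 (ix) The number of pairs $(A,B)\in\mathcal{F}$ with $|\{1,t\}\cap A|=0$ and $\{1,t\}\cap B=\{t\}$ is $$\mathfrak{T}\left(\theta,\alpha;\tfrac{\ell+1}{2},\tfrac{\ell^{\triangle}+1}{2},\tfrac{\ell^{\cap}-1}{2}\right)\cdot\mathtt{c}\bigl(\tfrac{\ell+1}{2};n\bigr)\cdot\mathtt{c}\bigl(\tfrac{\ell^{\triangle}+1}{2};N\bigr)\cdot\mathtt{c}\bigl(\tfrac{\ell^{\cap}-1}{2};j\bigr)\cdot\binom{N-1}{j'-j}.$$ (x) The number of pairs $(A,B)\in\mathcal{F}$ with $\{1,t\}\cap A=\{1,t\}\cap B=\{t\}$ is $$\mathfrak{T}\left(\theta,\beta;\tfrac{\ell+1}{2},\tfrac{\ell^{\triangle}-1}{2},\tfrac{\ell^{\cap}+1}{2}\right)\cdot\mathtt{c}\bigl(\tfrac{\ell+1}{2};n\bigr)\cdot\mathtt{c}\bigl(\tfrac{\ell^{\triangle}-1}{2};N\bigr)\cdot\mathtt{c}\bigl(\tfrac{\ell^{\cap}+1}{2};j\bigr)\cdot\binom{N}{j'-j}.$$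
   Context: The distinguished symmetric cycle $\boldsymbol{R}$ of the hypercube graph on $\{1,-1\}^t$ has vertices $R^0,\ldots,R^{2t-1}$, where $R^0=(1,\ldots,1)$; for $1\le s\le t-1$, $R^s\in\{1,-1\}^t$ has entries $-1$ exactly in positions $1,\ldots,s$; and $R^{k+t}=-R^k$ for $0\le k\le t-1$. The vectors $R^0,\ldots,R^{t-1}$ form a basis of $\mathbb{R}^t$, and for every $T\in\{1,-1\}^t$ there is a unique $\boldsymbol{x}=(x_1,\ldots,x_t)\in\{-1,0,1\}^t$ with $T=\sum_{i=1}^t x_iR^{i-1}$. Put $\boldsymbol{Q}(T,\boldsymbol{R})=\{x_iR^{i-1}\colon x_i\ne 0\}$; it is the unique inclusion-minimal subset of $\{R^0,\ldots,R^{2t-1}\}$ with sum $T$, and it has odd cardinality. For $A\subseteq E_t=\{1,\ldots,t\}$, ${}_{-A}\mathrm{T}^{(+)}$ is the vector in $\{1,-1\}^t$ whose set of coordinates equal to $-1$ is $A$, and $\mathfrak{q}(A)=|\boldsymbol{Q}({}_{-A}\mathrm{T}^{(+)},\boldsymbol{R})|$, i.e. the number of nonzero entries of the corresponding $\boldsymbol{x}$. $\mathtt{c}(m;n)=\binom{n-1}{m-1}$ is the number of compositions of the positive integer $n$ with $m$ positive parts (so $\mathtt{c}(0;n)=0$). $A\triangle B$ denotes the symmetric difference. Binomial coefficients $\binom{n}{k}$ with $k>n\ge 0$ are zero. A Smirnov word is a word in which any two adjacent letters differ. For $\mathfrak{s}',\mathfrak{s}''\in\{\theta,\alpha,\beta\}$,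 $\mathfrak{T}(\mathfrak{s}',\mathfrak{s}'';k,i,j)$ is the number of Smirnov words over the three-letter alphabet $(\theta,\alpha,\beta)$ that contain exactly $k$ letters $\theta$, $i$ letters $\alpha$ and $j$ letters $\beta$ (Parikh vector $(k,i,j)$), start with the letter $\mathfrak{s}'$ and end with the letter $\mathfrak{s}''$. *)

theory Defs
  imports Complex_Main
begin

text \<open>
  Vectors of \<open>\<real>\<^sup>t\<close> are functions \<open>nat \<Rightarrow> real\<close> with coordinates indexed by \<open>1, \<dots>, t\<close> and value
  \<open>0\<close> at every other index, so that equality of functions is equality of vectors.
\<close>

text \<open>The vertices \<open>R\<^sup>0, \<dots>, R\<^sup>2\<^sup>t\<^sup>-\<^sup>1\<close> of the distinguished symmetric cycle.\<close>

definition cycle_vertex :: "nat \<Rightarrow> nat \<Rightarrow> nat \<Rightarrow> real" where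
  "cycle_vertex t k = (\<lambda>e.
     if e \<notin> {1..t} then 0
     else if k < t then (if e \<le> k then - 1 else 1)
     else - (if e \<le> k - t then - 1 else 1))"

definition is_cycle_coords :: "nat \<Rightarrow> (nat \<Rightarrow> real) \<Rightarrow> (nat \<Rightarrow> real) \<Rightarrow> bool" where
  "is_cycle_coords t T x \<longleftrightarrow>
     (\<forall>i\<in>{1..t}. x i \<in> {- 1, 0, 1}) \<and> (\<forall>i. i \<notin> {1..t} \<longrightarrow> x i = 0) \<and>
     T = (\<lambda>e. \<Sum>i = 1..t. x i * cycle_vertex t (i - 1) e)"

text \<open>Well defined for vertices of the hypercube, see \<open>cycle_coords_ex1\<close> below.\<close>

definition cycle_coords :: "nat \<Rightarrow> (nat \<Rightarrow> real) \<Rightarrow> nat \<Rightarrow> real" where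
  "cycle_coords t T = (THE x. is_cycle_coords t T x)"

definition Q_set :: "nat \<Rightarrow> (nat \<Rightarrow> real) \<Rightarrow> (nat \<Rightarrow> real) set" where
  "Q_set t T =
     {(\<lambda>e. cycle_coords t T i * cycle_vertex t (i - 1) e) | i.
        i \<in> {1..t} \<and> cycle_coords t T i \<noteq> 0}"

definition neg_vertex :: "nat \<Rightarrow> nat set \<Rightarrow> nat \<Rightarrow> real" where
  "neg_vertex t A = (\<lambda>e. if e \<notin> {1..t} then 0 else if e \<in> A then - 1 else 1)"

definition qf :: "nat \<Rightarrow> nat set \<Rightarrow> nat" where
  "qf t A = card (Q_set t (neg_vertex t A))"

text \<open>The case \<open>m = 0\<close> is separate because \<open>m - 1\<close> is truncated on \<^typ>\<open>nat\<close>.\<close>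

definition compositions :: "nat \<Rightarrow> nat \<Rightarrow> nat" where
  "compositions m n = (if m = 0 then 0 else (n - 1) choose (m - 1))"

datatype letter = Theta | Alpha | Beta

definition smirnov_words :: "letter \<Rightarrow> letter \<Rightarrow> nat \<Rightarrow> nat \<Rightarrow> nat \<Rightarrow> letter list set" where
  "smirnov_words s s' k i j =
     {w. distinct_adj w \<and> w \<noteq> [] \<and> hd w = s \<and> last w = s' \<and>
         count_list w Theta = k \<and> count_list w Alpha = i \<and> count_list w Beta = j}"

definition smirnov_count :: "letter \<Rightarrow> letter \<Rightarrow> nat \<Rightarrow> nat \<Rightarrow> nat \<Rightarrow> nat" where
  "smirnov_count s s' k i j = card (smirnov_words s s' k i j)"

text \<open>\<open>j1\<close>, \<open>j2\<close> are the cardinalities of \<open>A\<close>, \<open>B\<close>; \<open>lD\<close>, \<open>lI\<close>, \<open>lU\<close> are the values of \<open>qf\<close> on the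
  symmetric difference, the intersection and the union.\<close>

definition pair_family ::
  "nat \<Rightarrow> nat \<Rightarrow> nat \<Rightarrow> nat \<Rightarrow> nat \<Rightarrow> nat \<Rightarrow> nat \<Rightarrow> (nat set \<times> nat set) set" where
  "pair_family t j1 j2 j lD lI lU =
     {(A, B). A \<subseteq> {1..t} \<and> B \<subseteq> {1..t} \<and>
        card A = j1 \<and> j1 < t \<and> card B = j2 \<and> j2 < t \<and>
        0 < card (A \<inter> B) \<and> card (A \<inter> B) = j \<and>
        max j1 j2 < card (A \<union> B) \<and> card (A \<union> B) < t \<and>
        qf t ((A - B) \<union> (B - A)) = lD \<and> qf t (A \<inter> B) = lI \<and> qf t (A \<union> B) = lU}"

lemma cycle_coords_ex1:
  assumes t: "1 \<le> t" and A: "A \<subseteq> {1..t}"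
  shows "\<exists>!x. is_cycle_coords t (neg_vertex t A) x"
proof -
  define T where "T = neg_vertex t A"
  have lin: "(\<Sum>i = 1..t. x i * cycle_vertex t (i - 1) (Suc e))
      = (\<Sum>i = 1..t. x i * cycle_vertex t (i - 1) e) + 2 * x (Suc e)"
    if "1 \<le> e" "Suc e \<le> t" for x :: "nat \<Rightarrow> real" and e
  proof -
    have "(\<Sum>i = 1..t. x i * cycle_vertex t (i - 1) (Suc e)) =
        (\<Sum>i = 1..t. x i * cycle_vertex t (i - 1) e + (if i = Suc e then 2 * x i else 0))"
      using that by (intro sum.cong) (auto simp: cycle_vertex_def)
    then show ?thesis using that by (simp add: sum.distrib)
  qed
  have first: "(\<Sum>i = 1..t. x i * cycle_vertex t (i - 1) 1) +
      (\<Sum>i = 1..t. x i * cycle_vertex t (i - 1) t) = 2 * x 1" for x :: "nat \<Rightarrow> real"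
  proof -
    have "(\<Sum>i = 1..t. x i * cycle_vertex t (i - 1) 1) +
        (\<Sum>i = 1..t. x i * cycle_vertex t (i - 1) t) =
        (\<Sum>i = 1..t. if i = 1 then 2 * x i else 0)"
      unfolding sum.distrib[symmetric] using t
      by (intro sum.cong) (auto simp: cycle_vertex_def)
    then show ?thesis using t by simp
  qed
  define y where "y = (\<lambda>i. if i \<notin> {1..t} then 0 else
     if i = 1 then (T 1 + T t) / 2 else (T i - T (i - 1)) / 2)"
  have y: "x = y" if "is_cycle_coords t T x" for x
  proof
    fix i
    have x0: "x i = 0" if "i \<notin> {1..t}"
      using \<open>is_cycle_coords t T x\<close> that by (auto simp: is_cycle_coords_def)
    have Te: "T e = (\<Sum>i = 1..t. x i * cycle_vertex t (i - 1) e)" for e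
      using \<open>is_cycle_coords t T x\<close> by (simp add: is_cycle_coords_def fun_eq_iff)
    consider "i \<notin> {1..t}" | "i = 1" "i \<in> {1..t}" | e where "i = Suc e" "1 \<le> e" "Suc e \<le> t"
      by (cases i) force+
    then show "x i = y i"
    proof cases
      case 1 then show ?thesis using x0 by (simp add: y_def)
    next
      case 2 then show ?thesis using first[of x] t by (simp add: y_def Te)
    next
      case 3 then show ?thesis using lin[of e x] by (simp add: y_def Te)
    qed
  qed
  define S where "S = (\<lambda>e. \<Sum>i = 1..t. y i * cycle_vertex t (i - 1) e)"
  have step: "S (Suc e) - T (Suc e) = S e - T e" if "1 \<le> e" "Suc e \<le> t" for e
  proof -
    have "2 * y (Suc e) = T (Suc e) - T e" using that by (simp add: y_def)
    then show ?thesis using lin[OF that, of y] by (simp add: S_def)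
  qed
  have const: "1 \<le> e \<Longrightarrow> e \<le> t \<Longrightarrow> S e - T e = S 1 - T 1" for e
  proof (induction e)
    case (Suc e)
    then show ?case using step[of e] by (cases "e = 0") auto
  qed simp
  have "S 1 + S t = T 1 + T t" proof -
    have "2 * y 1 = T 1 + T t" using t by (simp add: y_def)
    then show ?thesis using first[of y] by (simp add: S_def)
  qed
  then have "S 1 - T 1 = 0" using const[of t] t by simp
  then have inside: "S e = T e" if "e \<in> {1..t}" for e using const[of e] that by auto
  have outside: "S e = T e" if "e \<notin> {1..t}" for e
    using that by (auto simp: S_def T_def cycle_vertex_def neg_vertex_def intro!: sum.neutral)
  have "T = S" using inside outside by (metis ext)
  moreover have "y i \<in> {- 1, 0, 1}" if "i \<in> {1..t}" for i
    using that t by (auto simp: y_def T_def neg_vertex_def)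
  ultimately have "is_cycle_coords t T y"
    by (auto simp: is_cycle_coords_def S_def y_def)
  then show ?thesis using y unfolding T_def by blast
qed

end

theory Submission
  imports Defs
begin

text \<open>
  A pair \<open>(A, B)\<close> of subsets of \<open>{1..t}\<close> is read as a word of length \<open>t\<close> over three letters: position
  \<open>p\<close> carries Theta if it lies in neither set, Alpha if it lies in exactly one of them, Beta if it
  lies in both.  What the word forgets is which Alpha positions belong to \<open>A\<close>, so pairs correspond
  to words together with a set \<open>S = A - B\<close> of Alpha positions (\<open>pair_encoding_bij\<close>).  The
  cardinalities in the family say how often each letter occurs, and how large \<open>S\<close> is.

  The coordinates of a vertex in the basis \<open>R\<^sup>0, \<dots>, R\<^sup>t\<^sup>-\<^sup>1\<close> are half-differences of neighbouring entries,
  apart from the first one, which is half the sum of the first and the last entry.  Hence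
  \<open>qf t X\<close> counts the places where membership in \<open>X\<close> changes, plus one if \<open>1\<close> and \<open>t\<close> agree about
  membership (\<open>qf_eq\<close>).  A maximal run of consecutive members is bounded by two changes unless it
  touches an end of \<open>{1..t}\<close>; so \<open>X\<close> has \<open>(q + 1) / 2\<close> runs if it contains \<open>1\<close> or \<open>t\<close>, and
  \<open>(q - 1) / 2\<close> runs otherwise (\<open>qf_eq_iff_runs\<close>).  The symmetric difference and the intersection are
  the Alpha and the Beta positions; the union is the complement of the Theta positions, and
  complementation preserves \<open>qf\<close>.  So the three conditions on \<open>qf\<close> prescribe the number of runs of
  each letter.

  Collapsing every run of a word to a single letter gives a Smirnov word with the same first and last
  letter, whose letter counts are the numbers of runs.  Conversely, a word is recovered from its
  collapse by choosing, for every letter, a composition of the number of its occurrences into as many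
  parts as it has runs (\<open>card_words_collapsing_to\<close>).  This gives the Smirnov number and the three
  composition numbers.  The remaining binomial coefficient counts the sets \<open>S\<close>: whether an Alpha at an
  end of the word belongs to \<open>S\<close> is dictated by the conditions on \<open>{1, t}\<close>, the other Alpha positions are
  free.  The lemma \<open>card_pairs_with_endpoints\<close> carries this out for an arbitrary pair of traces on
  \<open>{1, t}\<close>; the ten formulas are its instances.
\<close>

section \<open>Words with a given collapse\<close>

text \<open>
  The number of compositions of \<open>n\<close> into \<open>m\<close> parts with \<open>n = 0\<close> included.  At \<open>n = 0\<close> the binomial
  formula in \<open>compositions\<close> would give \<open>1\<close> for \<open>m = 1\<close> and \<open>0\<close> for \<open>m = 0\<close>, because subtraction is
  truncated; the corrected values make the Pascal recursion below hold everywhere.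
\<close>

definition splittings :: "nat \<Rightarrow> nat \<Rightarrow> nat" where
  "splittings m n = (if n = 0 then of_bool (m = 0) else compositions m n)"

lemma splittings_0_left: "splittings 0 n = of_bool (n = 0)"
  by (simp add: splittings_def compositions_def)

lemma splittings_Suc_0: "splittings (Suc m) 0 = 0"
  by (simp add: splittings_def)

text \<open>
  Decrease the first part by one: it either stays positive or disappears.
\<close>

lemma splittings_Suc_Suc:
  "splittings (Suc m) (Suc n) = splittings (Suc m) n + splittings m n"
  by (cases n; cases m) (simp_all add: splittings_def compositions_def)

definition words_collapsing_to :: "'a set \<Rightarrow> 'a list \<Rightarrow> ('a \<Rightarrow> nat) \<Rightarrow> 'a list set" where
  "words_collapsing_to X v f = {w. remdups_adj w = v \<and> (\<forall>x\<in>X. count_list w x = f x)}"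

text \<open>
  Deleting the first letter of a word either shortens its first run or removes that run.
\<close>

lemma remdups_adj_eq_Cons_iff:
  assumes "distinct_adj (x # v)"
  shows "remdups_adj (y # w) = x # v \<longleftrightarrow>
    y = x \<and> (remdups_adj w = x # v \<or> remdups_adj w = v)"
  using assms by (cases v) (auto simp: remdups_adj_Cons split: list.splits)

text \<open>
  The union is disjoint, as the two kinds of words have different collapses, so this is a
  recursion for the number of words.  It matches the recursion of \<open>splittings\<close> for the letter \<open>x\<close>,
  while the factors of the other letters do not change.
\<close>

lemma words_collapsing_to_Cons_Suc:
  assumes "distinct_adj (x # v)" "x \<in> X" "f x = Suc m"
  shows "words_collapsing_to X (x # v) f =
    (#) x ` (words_collapsing_to X (x # v) (f(x := m)) \<union> words_collapsing_to X v (f(x := m)))"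
    (is "?L = _ ` ?R")
proof (intro equalityI subsetI)
  fix w assume w: "w \<in> ?L"
  then obtain y w' where yw: "w = y # w'"
    by (cases w) (auto simp: words_collapsing_to_def)
  have y: "y = x" "remdups_adj w' = x # v \<or> remdups_adj w' = v"
    using w remdups_adj_eq_Cons_iff[OF assms(1)]
    by (auto simp: words_collapsing_to_def yw)
  have "count_list w' z = (f(x := m)) z" if "z \<in> X" for z
    using w that assms(2,3) y(1) by (auto simp: words_collapsing_to_def yw split: if_splits)
  then show "w \<in> (#) x ` ?R"
    using y yw by (auto simp: words_collapsing_to_def)
next
  fix w assume "w \<in> (#) x ` ?R"
  then obtain w' where "w = x # w'" "w' \<in> ?R" by blast
  then show "w \<in> ?L"
    using assms remdups_adj_eq_Cons_iff[OF assms(1), of x w']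
    by (auto simp: words_collapsing_to_def)
qed

lemma prod_splittings_step:
  assumes "finite X" "x \<in> X" "f x = Suc m"
  shows "(\<Prod>y\<in>X. splittings (count_list (x # v) y) (f y)) =
    (\<Prod>y\<in>X. splittings (count_list (x # v) y) ((f(x := m)) y)) +
    (\<Prod>y\<in>X. splittings (count_list v y) ((f(x := m)) y))"
proof -
  have rest1: "(\<Prod>y\<in>X - {x}. splittings (count_list (x # v) y) ((f(x := m)) y)) =
      (\<Prod>y\<in>X - {x}. splittings (count_list (x # v) y) (f y))"
    by (rule prod.cong) auto
  have rest2: "(\<Prod>y\<in>X - {x}. splittings (count_list v y) ((f(x := m)) y)) =
      (\<Prod>y\<in>X - {x}. splittings (count_list (x # v) y) (f y))"
    by (rule prod.cong) auto
  show ?thesis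
    unfolding prod.remove[OF assms(1,2)] rest1 rest2
    using assms(3) by (simp add: splittings_Suc_Suc distrib_right)
qed

text \<open>
  The runs of different letters can be stretched independently.  The proof is an induction on the
  collapse, with an inner induction on the number of occurrences of its first letter.
\<close>

lemma card_words_collapsing_to:
  assumes "finite X" "set v \<subseteq> X" "distinct_adj v"
  shows "finite (words_collapsing_to X v f) \<and>
    card (words_collapsing_to X v f) = (\<Prod>x\<in>X. splittings (count_list v x) (f x))"
  using assms(2,3)
proof (induction v arbitrary: f)
  case Nil
  have "words_collapsing_to X [] f = (if \<forall>x\<in>X. f x = 0 then {[]} else {})"
    by (auto simp: words_collapsing_to_def)
  moreover have "(\<Prod>x\<in>X. splittings 0 (f x)) = of_bool (\<forall>x\<in>X. f x = 0)"
    using assms(1) by (auto simp: splittings_0_left intro!: prod.neutral)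
  ultimately show ?case by simp
next
  case (Cons x v)
  have x: "x \<in> X" and v: "set v \<subseteq> X" "distinct_adj v"
    using Cons.prems by (auto simp: distinct_adj_Cons)
  show ?case
  proof (induction "f x" arbitrary: f)
    case 0
    have "count_list w x \<noteq> f x" if "remdups_adj w = x # v" for w
      using that 0 by (metis count_list_0_iff list.set_intros(1) remdups_adj_set)
    then have "words_collapsing_to X (x # v) f = {}"
      using x by (auto simp: words_collapsing_to_def)
    moreover have "\<exists>y\<in>X. splittings (count_list (x # v) y) (f y) = 0"
      using x 0 by (intro bexI[of _ x]) (simp_all add: splittings_Suc_0 flip: 0)
    ultimately show ?case
      using assms(1) by (auto simp del: count_list.simps)
  next
    case (Suc m)
    let ?f = "f(x := m)"
    let ?R1 = "words_collapsing_to X (x # v) ?f" and ?R2 = "words_collapsing_to X v ?f"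
    have fin: "finite ?R1" "finite ?R2"
      using Suc.hyps(1)[of ?f, simplified fun_upd_same, OF refl] Cons.IH[OF v, of ?f]
      by (simp_all del: count_list.simps fun_upd_apply)
    have disj: "?R1 \<inter> ?R2 = {}"
      by (auto simp: words_collapsing_to_def)
    have W: "words_collapsing_to X (x # v) f = (#) x ` (?R1 \<union> ?R2)"
      using words_collapsing_to_Cons_Suc[OF Cons.prems(2) x] Suc.hyps(2) by simp
    have "card (words_collapsing_to X (x # v) f) = card ?R1 + card ?R2"
      unfolding W using fin disj by (simp add: card_image card_Un_disjoint)
    also have "\<dots> = (\<Prod>y\<in>X. splittings (count_list (x # v) y) (f y))"
      using Suc.hyps(1)[of ?f, simplified fun_upd_same, OF refl] Cons.IH[OF v, of ?f]
        prod_splittings_step[where f = f, OF assms(1) x Suc.hyps(2)[symmetric], of v]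
      by (simp del: count_list.simps fun_upd_apply)
    finally show ?case using fin W by simp
  qed
qed

section \<open>Words with given ends, letter counts and run counts\<close>

lemma letter_UNIV: "(UNIV :: letter set) = {Theta, Alpha, Beta}"
  using letter.exhaust by blast

lemma all_letters_iff: "(\<forall>x. P x) \<longleftrightarrow> P Theta \<and> P Alpha \<and> P Beta"
  by (metis letter.exhaust)

lemma finite_letter: "finite (UNIV :: letter set)"
  by (simp add: letter_UNIV)

definition letter_words ::
  "letter \<Rightarrow> letter \<Rightarrow> (letter \<Rightarrow> nat) \<Rightarrow> (letter \<Rightarrow> nat) \<Rightarrow> letter list set" where
  "letter_words s s' r f =
     {w. w \<noteq> [] \<and> hd w = s \<and> last w = s' \<and>
         (\<forall>x. count_list (remdups_adj w) x = r x) \<and> (\<forall>x. count_list w x = f x)}"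

lemma finite_words_with_counts: "finite {w. \<forall>x::letter. count_list w x = f x}"
proof -
  have "length w = sum f UNIV" if "\<forall>x. count_list w x = f x" for w
    using sum_count_set[of w "UNIV :: letter set"] that by (simp add: letter_UNIV[symmetric] finite_letter)
  then have "{w. \<forall>x. count_list w x = f x} \<subseteq> {w. set w \<subseteq> UNIV \<and> length w = sum f UNIV}"
    by auto
  then show ?thesis
    by (rule finite_subset) (rule finite_lists_length_eq[OF finite_letter])
qed

lemma finite_letter_words: "finite (letter_words s s' r f)"
  by (rule finite_subset[OF _ finite_words_with_counts[of f]]) (auto simp: letter_words_def)

lemma card_letter_words:
  assumes "\<And>x. 0 < f x"
  shows "card (letter_words s s' r f) =
    smirnov_count s s' (r Theta) (r Alpha) (r Beta) *
    (compositions (r Theta) (f Theta) * compositions (r Alpha) (f Alpha) *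
     compositions (r Beta) (f Beta))"
proof -
  let ?V = "smirnov_words s s' (r Theta) (r Alpha) (r Beta)"
  let ?W = "\<lambda>v. words_collapsing_to UNIV v f"
  let ?c = "compositions (r Theta) (f Theta) * compositions (r Alpha) (f Alpha) *
     compositions (r Beta) (f Beta)"
  have V: "?V = {v. distinct_adj v \<and> v \<noteq> [] \<and> hd v = s \<and> last v = s' \<and>
      (\<forall>x. count_list v x = r x)}"
    by (simp add: smirnov_words_def all_letters_iff)
  have un: "letter_words s s' r f = (\<Union>v\<in>?V. ?W v)"
    unfolding V by (auto simp: letter_words_def words_collapsing_to_def)
  have finV: "finite ?V"
    unfolding V by (rule finite_subset[OF _ finite_words_with_counts[of r]]) auto
  have W: "finite (?W v) \<and> card (?W v) = ?c" if "v \<in> ?V" for v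
  proof -
    have v: "distinct_adj v" "\<And>x. count_list v x = r x"
      using that by (auto simp: V)
    from card_words_collapsing_to[OF finite_letter _ v(1), of f]
    have "finite (?W v)" "card (?W v) = (\<Prod>x\<in>UNIV. splittings (count_list v x) (f x))"
      by auto
    moreover have "splittings m (f x) = compositions m (f x)" for m x
      using assms[of x] by (simp add: splittings_def)
    ultimately show ?thesis
      by (simp add: v letter_UNIV)
  qed
  have "card (\<Union>v\<in>?V. ?W v) = (\<Sum>v\<in>?V. card (?W v))"
    using finV W by (intro card_UN_disjoint) (auto simp: words_collapsing_to_def)
  also have "\<dots> = card ?V * ?c"
    using W by simp
  finally show ?thesis
    by (simp add: un smirnov_count_def)
qed

section \<open>Subsets with a prescribed trace\<close>

text \<open>
  The part of \<open>S\<close> inside \<open>E\<close> is fixed, so only the part in \<open>P - E\<close> is chosen.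
\<close>

lemma card_subsets_with_trace:
  assumes "finite P" "D \<subseteq> E" "E \<subseteq> P"
  shows "card {S. S \<subseteq> P \<and> card S = a \<and> E \<inter> S = D} =
    (if card D \<le> a then (card P - card E) choose (a - card D) else 0)"
proof (cases "card D \<le> a")
  case False
  have "card D \<le> card S" if "S \<subseteq> P" "E \<inter> S = D" for S
    using that assms by (intro card_mono) (auto intro: finite_subset)
  then have no: "{S. S \<subseteq> P \<and> card S = a \<and> E \<inter> S = D} = {}"
    using False by auto
  show ?thesis unfolding no using False by simp
next
  case True
  have finD: "finite D" and finE: "finite E"
    using assms by (auto intro: finite_subset)
  have "bij_betw (\<lambda>S. S - D) {S. S \<subseteq> P \<and> card S = a \<and> E \<inter> S = D}
      {S. S \<subseteq> P - E \<and> card S = a - card D}"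
  proof (rule bij_betw_byWitness[where f' = "\<lambda>S. S \<union> D"])
    show "(\<lambda>S. S - D) ` {S. S \<subseteq> P \<and> card S = a \<and> E \<inter> S = D} \<subseteq>
        {S. S \<subseteq> P - E \<and> card S = a - card D}"
      using finD by (auto intro!: card_Diff_subset)
    have "card (S \<union> D) = a" if "S \<subseteq> P - E" "card S = a - card D" for S
    proof -
      have "finite S" "S \<inter> D = {}"
        using that assms finite_subset by blast+
      then show ?thesis using that finD True by (simp add: card_Un_disjoint)
    qed
    then show "(\<lambda>S. S \<union> D) ` {S. S \<subseteq> P - E \<and> card S = a - card D} \<subseteq>
        {S. S \<subseteq> P \<and> card S = a \<and> E \<inter> S = D}"
      using assms by auto
  qed (use assms in auto)
  then have "card {S. S \<subseteq> P \<and> card S = a \<and> E \<inter> S = D} =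
      card {S. S \<subseteq> P - E \<and> card S = a - card D}"
    by (rule bij_betw_same_card)
  also have "\<dots> = card (P - E) choose (a - card D)"
    using assms by (intro n_subsets) auto
  finally show ?thesis
    using True finE assms by (simp add: card_Diff_subset)
qed

section \<open>The size of the minimal decomposition and runs\<close>

definition boundary_count :: "nat \<Rightarrow> nat set \<Rightarrow> nat" where
  "boundary_count t A = card {i \<in> {2..t}. (i \<in> A) \<noteq> (i - 1 \<in> A)}"

text \<open>
  Consecutive coordinates \<open>i - 1\<close> and \<open>i\<close> agree in every basis vector except \<open>R\<^sup>i\<^sup>-\<^sup>1\<close>, and the first
  and last coordinates are opposite in every basis vector except \<open>R\<^sup>0\<close>.  A difference, respectively
  the sum, of entries therefore isolates a single coefficient.
\<close>

lemma is_cycle_coords_nonzero_iff: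
  assumes x: "is_cycle_coords t (neg_vertex t A) x" and i: "i \<in> {1..t}"
  shows "x i \<noteq> 0 \<longleftrightarrow> (if i = 1 then (1 \<in> A) = (t \<in> A) else (i \<in> A) \<noteq> (i - 1 \<in> A))"
proof -
  have T: "neg_vertex t A e = (\<Sum>k = 1..t. x k * cycle_vertex t (k - 1) e)" for e
    using x by (simp add: is_cycle_coords_def fun_eq_iff)
  show ?thesis
  proof (cases "i = 1")
    case True
    have "neg_vertex t A 1 + neg_vertex t A t = (\<Sum>k = 1..t. if k = 1 then 2 * x k else 0)"
      unfolding T sum.distrib[symmetric] using i
      by (intro sum.cong) (auto simp: cycle_vertex_def)
    also have "\<dots> = 2 * x 1" using i by simp
    finally show ?thesis
      using True i by (auto simp: neg_vertex_def split: if_splits)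
  next
    case False
    have "neg_vertex t A i - neg_vertex t A (i - 1) =
        (\<Sum>k = 1..t. if k = i then 2 * x k else 0)"
      unfolding T sum_subtractf[symmetric] using i False
      by (intro sum.cong) (auto simp: cycle_vertex_def)
    also have "\<dots> = 2 * x i" using i by simp
    finally show ?thesis
      using False i by (auto simp: neg_vertex_def split: if_splits)
  qed
qed

text \<open>
  Distinct indices give distinct vectors, so the cardinality of the decomposition is the number of
  nonzero coefficients.  For \<open>i < k\<close> the coordinates \<open>k - 1\<close> and \<open>k\<close> differ in \<open>R\<^sup>k\<^sup>-\<^sup>1\<close> but agree
  in \<open>R\<^sup>i\<^sup>-\<^sup>1\<close>.
\<close>

lemma scaled_cycle_vertices_neq:
  assumes "i \<in> {1..t}" "k \<in> {1..t}" "i < k" "a \<noteq> 0" "b \<noteq> 0"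
  shows "(\<lambda>e. a * cycle_vertex t (i - 1) e) \<noteq> (\<lambda>e. b * cycle_vertex t (k - 1) e)"
proof
  assume eq: "(\<lambda>e. a * cycle_vertex t (i - 1) e) = (\<lambda>e. b * cycle_vertex t (k - 1) e)"
  have "a * cycle_vertex t (i - 1) (k - 1) = b * cycle_vertex t (k - 1) (k - 1)"
    "a * cycle_vertex t (i - 1) k = b * cycle_vertex t (k - 1) k"
    using fun_cong[OF eq] by auto
  then have "a = - b" "a = b"
    using assms by (auto simp: cycle_vertex_def split: if_splits)
  then show False using assms by simp
qed

lemma qf_eq:
  assumes t: "1 \<le> t" and A: "A \<subseteq> {1..t}"
  shows "qf t A = of_bool ((1 \<in> A) = (t \<in> A)) + boundary_count t A"
proof -
  define x where "x = cycle_coords t (neg_vertex t A)"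
  have x: "is_cycle_coords t (neg_vertex t A) x"
    unfolding x_def cycle_coords_def by (rule theI'[OF cycle_coords_ex1[OF t A]])
  let ?I = "{i \<in> {1..t}. x i \<noteq> 0}"
  have "Q_set t (neg_vertex t A) = (\<lambda>i e. x i * cycle_vertex t (i - 1) e) ` ?I"
    by (auto simp: Q_set_def x_def)
  moreover have "inj_on (\<lambda>i e. x i * cycle_vertex t (i - 1) e) ?I"
  proof (rule inj_onI)
    fix i k assume "i \<in> ?I" "k \<in> ?I"
      "(\<lambda>e. x i * cycle_vertex t (i - 1) e) = (\<lambda>e. x k * cycle_vertex t (k - 1) e)"
    then show "i = k"
      using scaled_cycle_vertices_neq[of i t k "x i" "x k"]
        scaled_cycle_vertices_neq[of k t i "x k" "x i"]
      by (cases i k rule: linorder_cases) auto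
  qed
  ultimately have "qf t A = card ?I"
    by (simp add: qf_def card_image)
  also have "?I = {i. i = 1 \<and> (1 \<in> A) = (t \<in> A)} \<union> {i \<in> {2..t}. (i \<in> A) \<noteq> (i - 1 \<in> A)}"
    (is "_ = ?S")
  proof (rule set_eqI)
    fix i
    have "i \<in> ?I \<longleftrightarrow> i \<in> {1..t} \<and>
        (if i = 1 then (1 \<in> A) = (t \<in> A) else (i \<in> A) \<noteq> (i - 1 \<in> A))"
      using is_cycle_coords_nonzero_iff[OF x, of i] by blast
    also have "\<dots> \<longleftrightarrow> i \<in> ?S"
      using t by (cases "i = 1") auto
    finally show "i \<in> ?I \<longleftrightarrow> i \<in> ?S" .
  qed
  also have "card \<dots> = card {i::nat. i = 1 \<and> (1 \<in> A) = (t \<in> A)} + boundary_count t A"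
    unfolding boundary_count_def by (rule card_Un_disjoint) auto
  also have "card {i::nat. i = 1 \<and> (1 \<in> A) = (t \<in> A)} = of_bool ((1 \<in> A) = (t \<in> A))"
    by (cases "(1 \<in> A) = (t \<in> A)") auto
  finally show ?thesis .
qed

lemma qf_compl:
  assumes t: "1 \<le> t" and A: "A \<subseteq> {1..t}"
  shows "qf t ({1..t} - A) = qf t A"
proof -
  have "boundary_count t ({1..t} - A) = boundary_count t A"
    unfolding boundary_count_def by (rule arg_cong[where f = card]) auto
  then show ?thesis
    using assms by (simp add: qf_eq)
qed

text \<open>
  Every run has two ends.  An end of a run is a place where membership changes, or one of the two
  ends of the whole word.
\<close>

lemma boundary_count_eq_runs:
  assumes "1 \<le> t"
  shows "boundary_count t {p \<in> {1..t}. g p = x} + of_bool (g 1 = x) + of_bool (g t = x) =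
    2 * count_list (remdups_adj (map g [1..<Suc t])) x"
  using assms
proof (induction t rule: dec_induct)
  case base
  then show ?case by (auto simp: boundary_count_def)
next
  case (step t)
  let ?B = "\<lambda>t. {i \<in> {2..t}. (i \<in> {p \<in> {1..t}. g p = x}) \<noteq> (i - 1 \<in> {p \<in> {1..t}. g p = x})}"
  have "?B (Suc t) = (if (g t = x) \<noteq> (g (Suc t) = x) then insert (Suc t) (?B t) else ?B t)"
    using step.hyps by (auto simp: le_Suc_eq)
  then have b: "boundary_count (Suc t) {p \<in> {1..Suc t}. g p = x} =
      boundary_count t {p \<in> {1..t}. g p = x} + of_bool ((g t = x) \<noteq> (g (Suc t) = x))"
    unfolding boundary_count_def by simp
  have l: "map g [1..<Suc (Suc t)] = map g [1..<t] @ [g t, g (Suc t)]"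
    "map g [1..<Suc t] = map g [1..<t] @ [g t]"
    using step.hyps by auto
  show ?case
    using step.IH unfolding b l remdups_adj_append_two by (auto split: if_splits)
qed

text \<open>
  If neither end carries \<open>x\<close>, the number of changes is twice the number of runs and the ends agree; if
  exactly one end does, one change is lost and the ends disagree; if both do, two changes are lost and
  the ends agree.  The last two cases both give twice the number of runs minus one.
\<close>

lemma qf_eq_iff_runs:
  assumes t: "1 \<le> t" and l: "odd l"
  shows "qf t {p \<in> {1..t}. g p = x} = l \<longleftrightarrow>
    count_list (remdups_adj (map g [1..<Suc t])) x =
      (if g 1 = x \<or> g t = x then (l + 1) div 2 else (l - 1) div 2)"
proof -
  have q: "qf t {p \<in> {1..t}. g p = x} =
      of_bool ((g 1 = x) = (g t = x)) + boundary_count t {p \<in> {1..t}. g p = x}"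
    using t by (subst qf_eq) auto
  obtain m where m: "l = 2 * m + 1" using l by (rule oddE)
  show ?thesis
    using boundary_count_eq_runs[OF t, of g x] unfolding q m by auto
qed

lemma count_list_map_upt: "count_list (map g [1..<Suc t]) x = card {p \<in> {1..t}. g p = x}"
proof (induction t)
  case (Suc t)
  have "{p \<in> {1..Suc t}. g p = x} =
      (if g (Suc t) = x then insert (Suc t) {p \<in> {1..t}. g p = x} else {p \<in> {1..t}. g p = x})"
    by (auto simp: le_Suc_eq)
  then show ?case using Suc.IH by simp
qed simp

section \<open>Pairs of sets as words\<close>

definition pair_letter :: "nat set \<Rightarrow> nat set \<Rightarrow> nat \<Rightarrow> letter" where
  "pair_letter A B p =
     (if p \<in> A \<inter> B then Beta else if p \<in> A \<union> B then Alpha else Theta)"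

definition pair_word :: "nat \<Rightarrow> nat set \<Rightarrow> nat set \<Rightarrow> letter list" where
  "pair_word t A B = map (pair_letter A B) [1..<Suc t]"

definition positions :: "letter list \<Rightarrow> letter \<Rightarrow> nat set" where
  "positions w x = {p \<in> {1..length w}. w ! (p - 1) = x}"

definition letters_at :: "nat \<Rightarrow> nat set \<Rightarrow> nat set \<Rightarrow> letter \<Rightarrow> nat set" where
  "letters_at t A B x = {p \<in> {1..t}. pair_letter A B p = x}"

lemma letters_at_eq:
  assumes "A \<subseteq> {1..t}" "B \<subseteq> {1..t}"
  shows "letters_at t A B Theta = {1..t} - (A \<union> B)"
    and "letters_at t A B Alpha = (A - B) \<union> (B - A)"
    and "letters_at t A B Beta = A \<inter> B"
  using assms by (auto simp: letters_at_def pair_letter_def)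

lemma positions_pair_word: "positions (pair_word t A B) x = letters_at t A B x"
proof -
  have "pair_word t A B ! (p - 1) = pair_letter A B p" if "p \<in> {1..t}" for p
    using that by (cases p) (simp_all add: pair_word_def del: upt_Suc)
  then show ?thesis
    by (auto simp: positions_def letters_at_def pair_word_def)
qed

lemma card_positions: "card (positions w x) = count_list w x"
proof -
  have "w = map (\<lambda>p. w ! (p - 1)) [1..<Suc (length w)]"
    by (rule nth_equalityI) (simp_all del: upt_Suc)
  then have "count_list w x = count_list (map (\<lambda>p. w ! (p - 1)) [1..<Suc (length w)]) x"
    by (rule arg_cong)
  then show ?thesis
    unfolding count_list_map_upt positions_def by (rule sym)
qed

lemma hd_last_pair_word:
  assumes "1 \<le> t"
  shows "pair_word t A B \<noteq> []" "hd (pair_word t A B) = pair_letter A B 1"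
    "last (pair_word t A B) = pair_letter A B t"
  using assms by (auto simp: pair_word_def hd_map last_map hd_upt simp del: upt_Suc)

text \<open>
  Both sides fix the sizes of the four cells \<open>A \<inter> B\<close>, \<open>A - B\<close>, \<open>B - A\<close> and the complement of
  \<open>A \<union> B\<close>.
\<close>

lemma pair_cards_iff_word_counts:
  assumes A: "A \<subseteq> {1..t}" and B: "B \<subseteq> {1..t}"
    and j: "j < j'" "j < j''" "j' + j'' - j < t"
  shows "card A = j' \<and> card B = j'' \<and> card (A \<inter> B) = j \<longleftrightarrow>
    card (A - B) = j' - j \<and> count_list (pair_word t A B) Beta = j \<and>
    count_list (pair_word t A B) Alpha = j' + j'' - 2 * j \<and>
    count_list (pair_word t A B) Theta = t - (j' + j'' - j)"
proof -
  have fin: "finite A" "finite B"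
    using A B by (auto intro: finite_subset)
  have cA: "card A = card (A \<inter> B) + card (A - B)"
    using card_Int_Diff[OF fin(1)] .
  have cB: "card B = card (A \<inter> B) + card (B - A)"
    using card_Int_Diff[OF fin(2), of A] by (simp only: Int_commute)
  have cD: "card ((A - B) \<union> (B - A)) = card (A - B) + card (B - A)"
    using fin by (intro card_Un_disjoint) auto
  have cU: "card ({1..t} - (A \<union> B)) = t - card (A \<union> B)"
    using fin A B by (subst card_Diff_subset) auto
  have AB: "card A + card B = card (A \<union> B) + card (A \<inter> B)"
    using fin by (rule card_Un_Int)
  have counts: "count_list (pair_word t A B) x = card (letters_at t A B x)" for x
    by (simp add: positions_pair_word flip: card_positions)
  show ?thesis
    unfolding counts letters_at_eq[OF A B] cD cU using cA cB AB j
    by (intro iffI conjI; elim conjE; linarith)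
qed

text \<open>
  The number of runs of the letter \<open>x\<close> that a value \<open>l\<close> of \<open>qf\<close> amounts to in a word with first
  letter \<open>s\<close> and last letter \<open>s'\<close>.
\<close>

definition run_number :: "nat \<Rightarrow> letter \<Rightarrow> letter \<Rightarrow> letter \<Rightarrow> nat" where
  "run_number l s s' x = (if s = x \<or> s' = x then (l + 1) div 2 else (l - 1) div 2)"

lemma qf_pair_iff_runs:
  assumes t: "1 \<le> t" and A: "A \<subseteq> {1..t}" and B: "B \<subseteq> {1..t}"
    and q: "odd lD" "odd lI" "odd lU"
  shows "qf t ((A - B) \<union> (B - A)) = lD \<and> qf t (A \<inter> B) = lI \<and> qf t (A \<union> B) = lU \<longleftrightarrow>
    (\<forall>x. count_list (remdups_adj (pair_word t A B)) x =
      run_number (case x of Theta \<Rightarrow> lU | Alpha \<Rightarrow> lD | Beta \<Rightarrow> lI)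
        (pair_letter A B 1) (pair_letter A B t) x)"
proof -
  have runs: "qf t (letters_at t A B x) = l \<longleftrightarrow>
      count_list (remdups_adj (pair_word t A B)) x =
        run_number l (pair_letter A B 1) (pair_letter A B t) x" if "odd l" for l x
    unfolding letters_at_def pair_word_def run_number_def by (rule qf_eq_iff_runs[OF t that])
  have union: "qf t (letters_at t A B Theta) = qf t (A \<union> B)"
    unfolding letters_at_eq[OF A B] using t A B by (intro qf_compl) auto
  show ?thesis
    unfolding all_letters_iff letter.case runs[OF q(1), symmetric] runs[OF q(2), symmetric]
      runs[OF q(3), symmetric] union letters_at_eq(2,3)[OF A B] by blast
qed

text \<open>
  A position is described by its letter together with its membership in \<open>A - B\<close>, which resolves the
  ambiguity of Alpha.
\<close>

lemma endpoint_conditions_iff: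
  assumes "C \<subseteq> E" "D \<subseteq> E"
  shows "E \<inter> A = C \<and> E \<inter> B = D \<longleftrightarrow>
    (\<forall>p\<in>E. pair_letter A B p = pair_letter C D p) \<and> E \<inter> (A - B) = C - D"
proof -
  have pointwise: "(p \<in> A \<longleftrightarrow> p \<in> C) \<and> (p \<in> B \<longleftrightarrow> p \<in> D) \<longleftrightarrow>
      pair_letter A B p = pair_letter C D p \<and> (p \<in> A - B \<longleftrightarrow> p \<in> C - D)" for p
    by (cases "p \<in> A"; cases "p \<in> B"; cases "p \<in> C"; cases "p \<in> D")
      (simp_all add: pair_letter_def)
  have sets: "E \<inter> A = C \<longleftrightarrow> (\<forall>p\<in>E. p \<in> A \<longleftrightarrow> p \<in> C)" "E \<inter> B = D \<longleftrightarrow> (\<forall>p\<in>E. p \<in> B \<longleftrightarrow> p \<in> D)"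
    "E \<inter> (A - B) = C - D \<longleftrightarrow> (\<forall>p\<in>E. p \<in> A - B \<longleftrightarrow> p \<in> C - D)"
    using assms by blast+
  show ?thesis
    unfolding sets ball_conj_distrib[symmetric] pointwise ..
qed

text \<open>
  From \<open>(w, S)\<close> the pair is recovered by giving the Beta positions to both sets, the Alpha positions in
  \<open>S\<close> to \<open>A\<close> only and the other Alpha positions to \<open>B\<close> only.
\<close>

lemma pair_encoding_bij:
  "bij_betw (\<lambda>(A, B). (pair_word t A B, A - B)) (Pow {1..t} \<times> Pow {1..t})
     (SIGMA w:{w. length w = t}. Pow (positions w Alpha))"
proof (rule bij_betw_byWitness
    [where f' = "\<lambda>(w, S). (S \<union> positions w Beta, (positions w Alpha - S) \<union> positions w Beta)"])
  have decode: "pair_word t (S \<union> positions w Beta) (positions w Alpha - S \<union> positions w Beta) = w"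
    "(S \<union> positions w Beta) - (positions w Alpha - S \<union> positions w Beta) = S"
    if t: "length w = t" and S: "S \<subseteq> positions w Alpha" for w S
  proof -
    have "pair_letter (S \<union> positions w Beta) (positions w Alpha - S \<union> positions w Beta) (Suc i)
        = w ! i" if "i < t" for i
      using that t S by (cases "w ! i") (auto simp: pair_letter_def positions_def)
    then show "pair_word t (S \<union> positions w Beta) (positions w Alpha - S \<union> positions w Beta) = w"
      using t by (intro nth_equalityI) (simp_all add: pair_word_def del: upt_Suc)
    show "(S \<union> positions w Beta) - (positions w Alpha - S \<union> positions w Beta) = S"
      using S by (auto simp: positions_def)
  qed
  show "\<forall>y\<in>SIGMA w:{w. length w = t}. Pow (positions w Alpha).
      (case case y of (w, S) \<Rightarrow>
          (S \<union> positions w Beta, positions w Alpha - S \<union> positions w Beta) of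
        (A, B) \<Rightarrow> (pair_word t A B, A - B)) = y"
  proof
    fix y assume "y \<in> (SIGMA w:{w. length w = t}. Pow (positions w Alpha))"
    then obtain w S where y: "y = (w, S)" and wS: "length w = t" "S \<subseteq> positions w Alpha"
      by blast
    show "(case case y of (w, S) \<Rightarrow>
          (S \<union> positions w Beta, positions w Alpha - S \<union> positions w Beta) of
        (A, B) \<Rightarrow> (pair_word t A B, A - B)) = y"
      unfolding y prod.case decode[OF wS] ..
  qed
  have encode: "A - B \<union> letters_at t A B Beta = A" "letters_at t A B Alpha - (A - B) \<union> letters_at t A B Beta = B"
    "A - B \<subseteq> letters_at t A B Alpha"
    if "A \<subseteq> {1..t}" "B \<subseteq> {1..t}" for A B
    unfolding letters_at_eq[OF that] using that by auto
  show "\<forall>a\<in>Pow {1..t} \<times> Pow {1..t}.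
      (case case a of (A, B) \<Rightarrow> (pair_word t A B, A - B) of (w, S) \<Rightarrow>
        (S \<union> positions w Beta, positions w Alpha - S \<union> positions w Beta)) = a"
  proof
    fix y assume "y \<in> Pow {1..t} \<times> Pow {1..t}"
    then obtain A B where y: "y = (A, B)" and AB: "A \<subseteq> {1..t}" "B \<subseteq> {1..t}"
      by blast
    show "(case case y of (A, B) \<Rightarrow> (pair_word t A B, A - B) of (w, S) \<Rightarrow>
        (S \<union> positions w Beta, positions w Alpha - S \<union> positions w Beta)) = y"
      unfolding y prod.case positions_pair_word encode[OF AB] ..
  qed
  have len: "length (pair_word t A B) = t" for A B
    by (simp add: pair_word_def)
  show "(\<lambda>(A, B). (pair_word t A B, A - B)) ` (Pow {1..t} \<times> Pow {1..t}) \<subseteq>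
      (SIGMA w:{w. length w = t}. Pow (positions w Alpha))"
  proof (rule image_subsetI)
    fix y assume "y \<in> Pow {1..t} \<times> Pow {1..t}"
    then obtain A B where y: "y = (A, B)" and AB: "A \<subseteq> {1..t}" "B \<subseteq> {1..t}"
      by blast
    show "(case y of (A, B) \<Rightarrow> (pair_word t A B, A - B)) \<in>
        (SIGMA w:{w. length w = t}. Pow (positions w Alpha))"
      using encode(3)[OF AB] by (simp only: y prod.case positions_pair_word len mem_Sigma_iff
          mem_Collect_eq Pow_iff simp_thms)
  qed
  show "(\<lambda>(w, S). (S \<union> positions w Beta, positions w Alpha - S \<union> positions w Beta)) `
      (SIGMA w:{w. length w = t}. Pow (positions w Alpha)) \<subseteq> Pow {1..t} \<times> Pow {1..t}"
    by (auto simp: positions_def)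
qed

text \<open>
  The encoding maps the pairs onto the words with prescribed ends, letter counts and run counts, each
  with the same number of admissible sets \<open>S\<close> over it.  The Alpha ends of the word are the elements of
  \<open>(C - D) \<union> (D - C)\<close>, and \<open>S\<close> must contain exactly those in \<open>C - D\<close>.  The case distinction is needed
  because there are no such sets if \<open>C - D\<close> has more than \<open>j' - j\<close> elements, where truncated subtraction
  would give a binomial coefficient with lower index \<open>0\<close>.
\<close>

lemma card_pairs_with_endpoints:
  assumes t: "3 \<le> t" and j0: "0 < j" and j: "j < j'" "j < j''" "j' + j'' - j < t"
    and q: "odd lD" "odd lI" "odd lU"
    and CD: "C \<subseteq> {1, t}" "D \<subseteq> {1, t}"
    and n: "n = t - (j' + j'' - j)" and N: "N = j' + j'' - 2 * j"
    and s: "s = pair_letter C D 1" and s': "s' = pair_letter C D t"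
  shows "card {(A, B). (A, B) \<in> pair_family t j' j'' j lD lI lU \<and>
      {1, t} \<inter> A = C \<and> {1, t} \<inter> B = D} =
    smirnov_count s s' (run_number lU s s' Theta) (run_number lD s s' Alpha)
      (run_number lI s s' Beta) *
    compositions (run_number lU s s' Theta) n * compositions (run_number lD s s' Alpha) N *
    compositions (run_number lI s s' Beta) j *
    (if card (C - D) \<le> j' - j
     then (N - card ((C - D) \<union> (D - C))) choose (j' - j - card (C - D)) else 0)"
    (is "card ?F = _ * ?b")
proof -
  define l where "l = (\<lambda>x. case x of Theta \<Rightarrow> lU | Alpha \<Rightarrow> lD | Beta \<Rightarrow> lI)"
  define r where "r = (\<lambda>x. run_number (l x) s s' x)"
  define f where "f = (\<lambda>x. case x of Theta \<Rightarrow> n | Alpha \<Rightarrow> N | Beta \<Rightarrow> j)"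
  define W where "W = letter_words s s' r f"
  define Sub where "Sub = (\<lambda>w. {S. S \<subseteq> positions w Alpha \<and> card S = j' - j \<and> {1, t} \<inter> S = C - D})"
  have len: "length w = t" if "w \<in> W" for w
  proof -
    have "length w = sum (count_list w) UNIV"
      using sum_count_set[of w UNIV] finite_letter by simp
    also have "\<dots> = n + N + j"
      using that by (simp add: letter_UNIV W_def letter_words_def f_def)
    also have "\<dots> = t" using n N j by simp
    finally show ?thesis .
  qed
  have t1: "1 \<le> t" using t by simp
  have mem: "(A, B) \<in> ?F \<longleftrightarrow> pair_word t A B \<in> W \<and> A - B \<in> Sub (pair_word t A B)"
    if A: "A \<subseteq> {1..t}" and B: "B \<subseteq> {1..t}" for A B
  proof -
    have fin: "finite A" "finite B"
      using A B by (auto intro: finite_subset)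
    have union: "card A + card B = card (A \<union> B) + card (A \<inter> B)"
      using fin by (rule card_Un_Int)
    have fam: "(A, B) \<in> pair_family t j' j'' j lD lI lU \<longleftrightarrow>
        (card A = j' \<and> card B = j'' \<and> card (A \<inter> B) = j) \<and>
        (qf t ((A - B) \<union> (B - A)) = lD \<and> qf t (A \<inter> B) = lI \<and> qf t (A \<union> B) = lU)"
      using A B j j0 union unfolding pair_family_def by auto
    have runs: "qf t ((A - B) \<union> (B - A)) = lD \<and> qf t (A \<inter> B) = lI \<and> qf t (A \<union> B) = lU \<longleftrightarrow>
        (\<forall>x. count_list (remdups_adj (pair_word t A B)) x =
          run_number (l x) (pair_letter A B 1) (pair_letter A B t) x)"
      unfolding l_def by (rule qf_pair_iff_runs[OF t1 A B q])
    have counts: "card A = j' \<and> card B = j'' \<and> card (A \<inter> B) = j \<longleftrightarrow>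
        card (A - B) = j' - j \<and> (\<forall>x. count_list (pair_word t A B) x = f x)"
      unfolding pair_cards_iff_word_counts[OF A B j] all_letters_iff f_def letter.case n N by blast
    have sub: "A - B \<subseteq> positions (pair_word t A B) Alpha"
      unfolding positions_pair_word letters_at_eq[OF A B] by blast
    have ends: "{1, t} \<inter> A = C \<and> {1, t} \<inter> B = D \<longleftrightarrow>
        pair_letter A B 1 = s \<and> pair_letter A B t = s' \<and> {1, t} \<inter> (A - B) = C - D"
      using endpoint_conditions_iff[OF CD, of A B] by (simp add: s s')
    have "(A, B) \<in> ?F \<longleftrightarrow>
        (A, B) \<in> pair_family t j' j'' j lD lI lU \<and> {1, t} \<inter> A = C \<and> {1, t} \<inter> B = D"
      by simp
    also have "\<dots> \<longleftrightarrow>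
        (card (A - B) = j' - j \<and> (\<forall>x. count_list (pair_word t A B) x = f x)) \<and>
        (\<forall>x. count_list (remdups_adj (pair_word t A B)) x = r x) \<and>
        pair_letter A B 1 = s \<and> pair_letter A B t = s' \<and> {1, t} \<inter> (A - B) = C - D"
      unfolding fam counts runs ends r_def by (auto simp only:)
    finally have F: "(A, B) \<in> ?F \<longleftrightarrow> \<dots>" .
    show ?thesis
      unfolding F unfolding W_def letter_words_def Sub_def mem_Collect_eq
      using sub hd_last_pair_word[OF t1, of A B] by (auto simp only:)
  qed
  have bij: "bij_betw (\<lambda>(A, B). (pair_word t A B, A - B)) ?F (SIGMA w:W. Sub w)"
  proof (rule bij_betw_subset[OF pair_encoding_bij[of t]])
    show "?F \<subseteq> Pow {1..t} \<times> Pow {1..t}"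
      by (auto simp: pair_family_def)
    show "(\<lambda>(A, B). (pair_word t A B, A - B)) ` ?F = (SIGMA w:W. Sub w)"
    proof (intro equalityI subsetI)
      fix y assume "y \<in> (\<lambda>(A, B). (pair_word t A B, A - B)) ` ?F"
      then obtain A B where AB: "(A, B) \<in> ?F" and y: "y = (pair_word t A B, A - B)"
        by force
      then have "A \<subseteq> {1..t}" "B \<subseteq> {1..t}"
        by (auto simp: pair_family_def)
      from mem[OF this] AB show "y \<in> (SIGMA w:W. Sub w)"
        unfolding y by blast
    next
      fix y assume y: "y \<in> (SIGMA w:W. Sub w)"
      then have "y \<in> (SIGMA w:{w. length w = t}. Pow (positions w Alpha))"
        using len by (auto simp: Sub_def)
      then obtain A B where AB: "A \<subseteq> {1..t}" "B \<subseteq> {1..t}" and yAB: "y = (pair_word t A B, A - B)"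
        unfolding bij_betw_imp_surj_on[OF pair_encoding_bij[of t], symmetric] by auto
      have "(A, B) \<in> ?F"
        using y mem[OF AB] unfolding yAB by blast
      then show "y \<in> (\<lambda>(A, B). (pair_word t A B, A - B)) ` ?F"
        unfolding yAB by force
    qed
  qed
  have fibre: "finite (Sub w) \<and> card (Sub w) = ?b" if "w \<in> W" for w
  proof -
    let ?E = "(C - D) \<union> (D - C)"
    have pos: "p \<in> positions w Alpha \<longleftrightarrow> p \<in> ?E" if "p \<in> {1, t}" for p
    proof -
      have "w \<noteq> []" "w ! 0 = s" "w ! (t - 1) = s'"
        using \<open>w \<in> W\<close> len[of w] by (auto simp: W_def letter_words_def hd_conv_nth last_conv_nth)
      then have "p \<in> positions w Alpha \<longleftrightarrow> pair_letter C D p = Alpha"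
        using len[OF \<open>w \<in> W\<close>] that t by (auto simp: positions_def s s')
      then show ?thesis by (auto simp: pair_letter_def)
    qed
    have E: "{1, t} \<inter> S = ?E \<inter> S" if "S \<subseteq> positions w Alpha" for S
      using that pos CD by blast
    have "Sub w = {S. S \<subseteq> positions w Alpha \<and> card S = j' - j \<and> ?E \<inter> S = C - D}"
      unfolding Sub_def using E by auto
    moreover have "finite (positions w Alpha)"
      by (simp add: positions_def)
    moreover have "?E \<subseteq> positions w Alpha"
      using pos CD by blast
    moreover have "card (positions w Alpha) = N"
      using that by (simp add: card_positions W_def letter_words_def f_def)
    ultimately show ?thesis
      using card_subsets_with_trace[of "positions w Alpha" "C - D" ?E "j' - j"] by simp
  qed
  have "card ?F = card (SIGMA w:W. Sub w)"
    by (rule bij_betw_same_card[OF bij])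
  also have "\<dots> = (\<Sum>w\<in>W. card (Sub w))"
    using fibre finite_letter_words[of s s' r f] by (intro card_SigmaI) (auto simp: W_def)
  also have "\<dots> = card W * ?b"
    using fibre by simp
  also have "card W = smirnov_count s s' (r Theta) (r Alpha) (r Beta) *
      (compositions (r Theta) n * compositions (r Alpha) N * compositions (r Beta) j)"
  proof -
    have "0 < f x" for x
      using j0 j n N by (cases x) (auto simp: f_def)
    from card_letter_words[OF this, of s s' r] show ?thesis
      by (simp add: W_def f_def)
  qed
  finally show ?thesis
    by (simp add: r_def l_def mult.assoc)
qed

section \<open>The ten cases\<close>

theorem theorem4p8:
  fixes t j' j'' j lD lI lU n N :: nat
  assumes "3 \<le> t"
    and "0 < j'" and "0 < j''" and "0 < j"
    and "j < min j' j''" and "j' + j'' - j < t"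
    and "lD \<in> {1..t}" and "odd lD"
    and "lI \<in> {1..t}" and "odd lI"
    and "lU \<in> {1..t}" and "odd lU"
    and "n = t - (j' + j'' - j)" and "N = j' + j'' - 2 * j"
  shows "(card {(A, B). (A, B) \<in> pair_family t j' j'' j lD lI lU \<and>
            {1, t} \<inter> A = {1} \<and> {1, t} \<inter> B = {1}} =
          smirnov_count Beta Theta ((lU + 1) div 2) ((lD - 1) div 2) ((lI + 1) div 2) *
          compositions ((lU + 1) div 2) n * compositions ((lD - 1) div 2) N *
          compositions ((lI + 1) div 2) j * (N choose (j' - j))) \<and>
         (card {(A, B). (A, B) \<in> pair_family t j' j'' j lD lI lU \<and>
            {1, t} \<inter> A = {1} \<and> {1, t} \<inter> B = {1, t}} =
          smirnov_count Beta Alpha ((lU - 1) div 2) ((lD + 1) div 2) ((lI + 1) div 2) *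
          compositions ((lU - 1) div 2) n * compositions ((lD + 1) div 2) N *
          compositions ((lI + 1) div 2) j * ((N - 1) choose (j' - j))) \<and>
         (card {(A, B). (A, B) \<in> pair_family t j' j'' j lD lI lU \<and>
            {1, t} \<inter> A = {1} \<and> card ({1, t} \<inter> B) = 0} =
          smirnov_count Alpha Theta ((lU + 1) div 2) ((lD + 1) div 2) ((lI - 1) div 2) *
          compositions ((lU + 1) div 2) n * compositions ((lD + 1) div 2) N *
          compositions ((lI - 1) div 2) j * ((N - 1) choose (j'' - j))) \<and>
         (card {(A, B). (A, B) \<in> pair_family t j' j'' j lD lI lU \<and>
            {1, t} \<inter> A = {1} \<and> {1, t} \<inter> B = {t}} =
          smirnov_count Alpha Alpha ((lU - 1) div 2) ((lD + 1) div 2) ((lI - 1) div 2) *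
          compositions ((lU - 1) div 2) n * compositions ((lD + 1) div 2) N *
          compositions ((lI - 1) div 2) j * ((N - 2) choose (j' - j - 1))) \<and>
         (card {(A, B). (A, B) \<in> pair_family t j' j'' j lD lI lU \<and>
            {1, t} \<inter> A = {1, t} \<and> {1, t} \<inter> B = {1, t}} =
          smirnov_count Beta Beta ((lU - 1) div 2) ((lD - 1) div 2) ((lI + 1) div 2) *
          compositions ((lU - 1) div 2) n * compositions ((lD - 1) div 2) N *
          compositions ((lI + 1) div 2) j * (N choose (j' - j))) \<and>
         (card {(A, B). (A, B) \<in> pair_family t j' j'' j lD lI lU \<and>
            {1, t} \<inter> A = {1, t} \<and> card ({1, t} \<inter> B) = 0} =
          smirnov_count Alpha Alpha ((lU - 1) div 2) ((lD + 1) div 2) ((lI - 1) div 2) *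
          compositions ((lU - 1) div 2) n * compositions ((lD + 1) div 2) N *
          compositions ((lI - 1) div 2) j * ((N - 2) choose (j'' - j))) \<and>
         (card {(A, B). (A, B) \<in> pair_family t j' j'' j lD lI lU \<and>
            {1, t} \<inter> A = {1, t} \<and> {1, t} \<inter> B = {t}} =
          smirnov_count Alpha Beta ((lU - 1) div 2) ((lD + 1) div 2) ((lI + 1) div 2) *
          compositions ((lU - 1) div 2) n * compositions ((lD + 1) div 2) N *
          compositions ((lI + 1) div 2) j * ((N - 1) choose (j'' - j))) \<and>
         (card {(A, B). (A, B) \<in> pair_family t j' j'' j lD lI lU \<and>
            card ({1, t} \<inter> A) = 0 \<and> card ({1, t} \<inter> B) = 0} =
          smirnov_count Theta Theta ((lU + 1) div 2) ((lD - 1) div 2) ((lI - 1) div 2) *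
          compositions ((lU + 1) div 2) n * compositions ((lD - 1) div 2) N *
          compositions ((lI - 1) div 2) j * (N choose (j' - j))) \<and>
         (card {(A, B). (A, B) \<in> pair_family t j' j'' j lD lI lU \<and>
            card ({1, t} \<inter> A) = 0 \<and> {1, t} \<inter> B = {t}} =
          smirnov_count Theta Alpha ((lU + 1) div 2) ((lD + 1) div 2) ((lI - 1) div 2) *
          compositions ((lU + 1) div 2) n * compositions ((lD + 1) div 2) N *
          compositions ((lI - 1) div 2) j * ((N - 1) choose (j' - j))) \<and>
         (card {(A, B). (A, B) \<in> pair_family t j' j'' j lD lI lU \<and>
            {1, t} \<inter> A = {t} \<and> {1, t} \<inter> B = {t}} =
          smirnov_count Theta Beta ((lU + 1) div 2) ((lD - 1) div 2) ((lI + 1) div 2) *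
          compositions ((lU + 1) div 2) n * compositions ((lD - 1) div 2) N *
          compositions ((lI + 1) div 2) j * (N choose (j' - j)))"
proof -
  have j: "j < j'" "j < j''" using assms by simp_all
  have t: "t \<noteq> Suc 0" "Suc 0 \<noteq> t" using assms by simp_all
  note count = card_pairs_with_endpoints[OF assms(1,4) j assms(6,8,10,12) _ _ assms(13,14) refl refl]
  have empty: "card ({1, t} \<inter> X) = 0 \<longleftrightarrow> {1, t} \<inter> X = {}" for X
    by (simp add: card_eq_0_iff)
  \<comment> \<open>If the pair lemma chooses the elements of \<open>A - B\<close> where the claim chooses those of \<open>B - A\<close>,
    the two lower indices of the binomial coefficient add up to the upper one.\<close>
  have flip1: "(N - Suc 0) choose (j' - Suc j) = (N - Suc 0) choose (j'' - j)"
    using j by (subst binomial_symmetric)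
      (auto simp: assms(14) intro!: arg_cong2[where f = binomial])
  have flip2: "(N - 2) choose (j' - Suc (Suc j)) = (N - 2) choose (j'' - j)" if "2 \<le> j' - j"
    using j that by (subst binomial_symmetric)
      (auto simp: assms(14) intro!: arg_cong2[where f = binomial])
  \<comment> \<open>If \<open>A - B\<close> is too small to contain both ends, the claimed binomial coefficient vanishes.\<close>
  have flip2_zero: "N - 2 < j'' - j" if "\<not> 2 \<le> j' - j"
    using j that by (simp add: assms(14))
  have "Suc 0 \<le> j' - j" using j by simp
  note eval = this pair_letter_def run_number_def insert_Diff_if numeral_2_eq_2[symmetric]
    t flip1 flip2 flip2_zero
  show ?thesis
    unfolding empty
  proof (intro conjI, goal_cases)
    case 1
    show ?case
      by (subst count) (simp_all add: eval)
  next
    case 2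
    show ?case
      by (subst count) (simp_all add: eval)
  next
    case 3
    show ?case
      by (subst count) (simp_all add: eval)
  next
    case 4
    show ?case
      by (subst count) (simp_all add: eval)
  next
    case 5
    show ?case
      by (subst count) (simp_all add: eval)
  next
    case 6
    show ?case
      by (subst count) (simp_all add: eval)
  next
    case 7
    show ?case
      by (subst count) (simp_all add: eval)
  next
    case 8
    show ?case
      by (subst count) (simp_all add: eval)
  next
    case 9
    show ?case
      by (subst count) (simp_all add: eval)
  next
    case 10
    show ?case
      by (subst count) (simp_all add: eval)
  qed
qed

end
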